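(* Let $n\ge2$ and $r\ge1$ be integers, and let $X_{n,r}$ be the size of $\rho^{r}(\tau)$ for a uniformly random Catalan--Stanley tree $\tau$ of size $n$. Then \[ \mathbb{E}X_{n,r} = \frac{1}{C_{n-2}}\binom{2n-2r-4}{n-2} + 1, \] where $C_m=\frac{1}{m+1}\binom{2m}{m}$ and $\binom{m}{j}$ is taken to be $0$ unless $0\le j\le m$.
   Context: A rooted plane tree has ordered children at every node; its size is its number of nodes. For each child $c$ of the root, the rightmost leaf of the branch at $c$ is the leaf reached from $c$ by repeatedly moving to the rightmost child. A Catalan--Stanley tree is a rooted plane tree in which every such rightmost leaf has odd distance to the root (the one-node tree is included); there are $C_{n-2}$ of size $n\ge 2$. The reduction $\rho$: for each rightmost leaf $\ell$ of a branch attached to the root, if $\ell$ is a child of the root it is deleted; otherwise all descendants of the grandparent of $\ell$ are deleted (the grandparent becomes a leaf); the one-node tree is mapped to itself. *)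

theory Defs
  imports "HOL-Probability.Probability"
begin

datatype plane_tree = Node "plane_tree list"

primrec children :: "plane_tree \<Rightarrow> plane_tree list" where
  "children (Node ts) = ts"

fun num_nodes :: "plane_tree \<Rightarrow> nat" where
  "num_nodes (Node ts) = 1 + sum_list (map num_nodes ts)"

text \<open>A node is identified by its address, i.e. the list of (zero-based) child indices that
  leads to it from the root. The length of the address is the distance to the root, and the
  parent is obtained by dropping the last entry.\<close>

function rightmost_leaf :: "plane_tree \<Rightarrow> nat list" where
  "rightmost_leaf (Node ts) =
     (if ts = [] then [] else (length ts - 1) # rightmost_leaf (last ts))"
  by pat_completeness auto
termination
proof (relation "Wellfounded.measure size", goal_cases)
  case (2 ts)
  then have "size (last ts) < Suc (size_list size ts)"
    by (intro le_imp_less_Suc size_list_estimation'[of "last ts"]) auto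
  then show ?case by simp
qed simp

fun delete_descendants :: "nat list \<Rightarrow> plane_tree \<Rightarrow> plane_tree" where
  "delete_descendants [] (Node ts) = Node []"
| "delete_descendants (i # a) (Node ts) = Node (ts[i := delete_descendants a (ts ! i)])"

text \<open>In the next two definitions the address \<open>rightmost_leaf c\<close> is relative to the child \<open>c\<close> of
  the root; hence the distance of that leaf to the root of the whole tree is one more than the
  length of the address.\<close>

definition catalan_stanley :: "plane_tree \<Rightarrow> bool" where
  "catalan_stanley t \<longleftrightarrow> (\<forall>c \<in> set (children t). odd (length (rightmost_leaf c) + 1))"

text \<open>A branch whose rightmost leaf is a child of the root is a single node and disappears. In a
  Catalan--Stanley tree, any other such leaf has distance at least 3 to the root, so that its
  grandparent belongs to the branch. Values on other trees are irrelevant.\<close>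

definition reduction :: "plane_tree \<Rightarrow> plane_tree" where
  "reduction t = Node
     (map (\<lambda>c. delete_descendants (butlast (butlast (rightmost_leaf c))) c)
       (filter (\<lambda>c. rightmost_leaf c \<noteq> []) (children t)))"

definition catalan_stanley_trees :: "nat \<Rightarrow> plane_tree set" where
  "catalan_stanley_trees n = {t. catalan_stanley t \<and> num_nodes t = n}"

definition catalan :: "nat \<Rightarrow> real" where
  "catalan m = 1 / (real m + 1) * real ((2 * m) choose m)"

definition int_binomial :: "int \<Rightarrow> int \<Rightarrow> nat" where
  "int_binomial m j = (if 0 \<le> j \<and> j \<le> m then nat m choose nat j else 0)"

end

theory Submission
  imports Defs "HOL-Computational_Algebra.Formal_Power_Series"
begin

text \<open>
  A plane tree with more than one node is uniquely of the form \<open>graft s c\<close>, where \<open>c\<close> is the last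
  branch at the root, so the generating function \<open>T\<close> of plane trees satisfies \<open>T = X + T\<^sup>2\<close>. A branch
  whose rightmost leaf has depth \<open>k\<close> in it is a spine of \<open>k\<close> nodes, each carrying a tree, and a
  final leaf; such branches are counted by \<open>X T\<^sup>k\<close>, and \<open>r\<close> reductions cut the last \<open>2r\<close> spine nodes.
  If \<open>E = X / (1 - T\<^sup>2)\<close> counts the branches with even \<open>k\<close>, then Catalan--Stanley trees are counted
  by \<open>X / (1 - E) = X (1 + T)\<close>, and the sum of the sizes of the reduced trees, not counting the root,
  has generating function \<open>X T\<^bsup>2r\<^esup> (X E') / (1 - E)\<^sup>2 = X\<^sup>2 T\<^bsup>2r\<^esup> T'\<close>. The coefficients of
  \<open>T\<^sup>p T'\<close> are binomial coefficients because \<open>T\<^bsup>p+1\<^esup> T' = X T\<^sup>p T' + T\<^bsup>p+2\<^esup> T'\<close> is Pascal's rule.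
\<close>

text \<open>Every last-branch decomposition below yields an affine equation for a generating
  function; solving it as a product avoids dividing power series.\<close>

lemma affine_fixed_point:
  fixes x :: "'a :: comm_ring_1"
  assumes "x = a + b * x"
  shows "x * (1 - b) = a"
proof -
  have "x - b * x = a" using assms by (metis add_diff_cancel_right')
  then show ?thesis by (simp add: algebra_simps)
qed

section \<open>Decomposition of plane trees at the last branch of the root\<close>

definition graft :: "plane_tree \<Rightarrow> plane_tree \<Rightarrow> plane_tree" where
  "graft s c = Node (children s @ [c])"

lemma graft_Node [simp]: "graft (Node us) c = Node (us @ [c])"
  by (simp add: graft_def)

lemma graft_not_leaf [simp]: "graft s c \<noteq> Node []"
  by (simp add: graft_def)

lemma graft_inject [simp]: "graft s c = graft s' c' \<longleftrightarrow> s = s' \<and> c = c'"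
  by (cases s; cases s') (auto simp: graft_def)

lemma num_nodes_graft [simp]: "num_nodes (graft s c) = num_nodes s + num_nodes c"
  by (cases s) simp

lemma num_nodes_pos: "num_nodes t > 0"
  by (cases t) simp

lemma graft_cases [case_names leaf graft]:
  obtains "t = Node []" | s c where "t = graft s c"
proof (cases t)
  case (Node ts)
  show ?thesis
  proof (cases ts rule: rev_cases)
    case Nil
    then show ?thesis using Node that(1) by simp
  next
    case (snoc us c)
    then show ?thesis using Node that(2)[of "Node us" c] by simp
  qed
qed

lemma graft_induct [case_names leaf graft]:
  assumes "P (Node [])" and "\<And>s c. P s \<Longrightarrow> P c \<Longrightarrow> P (graft s c)"
  shows "P t"
proof (induction "num_nodes t" arbitrary: t rule: less_induct)
  case less
  show ?case
  proof (cases t rule: graft_cases)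
    case leaf
    then show ?thesis using assms(1) by simp
  next
    case (graft s c)
    then show ?thesis
      using assms(2) less num_nodes_pos[of s] num_nodes_pos[of c] by simp
  qed
qed

text \<open>Both parts of a graft are strictly smaller than the whole. Finiteness ensures that the
  sums over trees of a fixed size are genuine sums and not the default 0.\<close>

lemma finite_num_nodes: "finite {t. num_nodes t = n}"
proof (induction n rule: less_induct)
  case (less n)
  have "{t. num_nodes t = n} \<subseteq> insert (Node [])
      ((\<lambda>(s, c). graft s c) ` (\<Union>i<n. \<Union>j<n. {s. num_nodes s = i} \<times> {c. num_nodes c = j}))"
  proof
    fix t assume t: "t \<in> {t. num_nodes t = n}"
    show "t \<in> insert (Node [])
      ((\<lambda>(s, c). graft s c) ` (\<Union>i<n. \<Union>j<n. {s. num_nodes s = i} \<times> {c. num_nodes c = j}))"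
    proof (cases t rule: graft_cases)
      case (graft s c)
      then have "(s, c) \<in> (\<Union>i<n. \<Union>j<n. {s. num_nodes s = i} \<times> {c. num_nodes c = j})"
        using t num_nodes_pos[of s] num_nodes_pos[of c] by auto
      then show ?thesis using graft by blast
    qed simp
  qed
  moreover have "finite \<dots>"
    using less by (intro finite.insertI finite_imageI finite_UN_I finite_cartesian_product) auto
  ultimately show ?case by (rule finite_subset)
qed

section \<open>Weighted generating functions of plane trees\<close>

definition tree_fps :: "(plane_tree \<Rightarrow> real) \<Rightarrow> real fps" where
  "tree_fps w = Abs_fps (\<lambda>n. \<Sum>t | num_nodes t = n. w t)"

lemma tree_fps_nth: "fps_nth (tree_fps w) n = (\<Sum>t | num_nodes t = n. w t)"
  by (simp add: tree_fps_def)

lemma tree_fps_add: "tree_fps (\<lambda>t. u t + v t) = tree_fps u + tree_fps v"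
  by (simp add: fps_eq_iff tree_fps_nth sum.distrib)

lemma tree_fps_zero: "tree_fps (\<lambda>t. 0) = 0"
  by (simp add: fps_eq_iff tree_fps_nth)

lemma tree_fps_num_nodes: "tree_fps (\<lambda>t. real (num_nodes t)) = fps_X * fps_deriv (tree_fps (\<lambda>_. 1))"
proof (rule fps_ext)
  fix n
  have "(\<Sum>t | num_nodes t = n. real (num_nodes t)) = (\<Sum>t | num_nodes t = n. real n)"
    by (rule sum.cong) auto
  then show "fps_nth (tree_fps (\<lambda>t. real (num_nodes t))) n
      = fps_nth (fps_X * fps_deriv (tree_fps (\<lambda>_. 1))) n"
    by (cases n) (simp_all add: tree_fps_nth)
qed

text \<open>Grafting is a bijection from pairs of trees onto the trees other than the single node.
  The index \<open>i\<close> is the size of \<open>s\<close>; the range \<open>0..n\<close> matches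
  the Cauchy product, and its end terms vanish because no tree has size 0.\<close>

lemma sum_graft:
  fixes w :: "plane_tree \<Rightarrow> real"
  shows "(\<Sum>t | num_nodes t = n. w t) = (if n = 1 then w (Node []) else 0)
    + (\<Sum>i = 0..n. \<Sum>s | num_nodes s = i. \<Sum>c | num_nodes c = n - i. w (graft s c))"
proof -
  let ?A = "\<lambda>n. {t. num_nodes t = n}"
  let ?P = "SIGMA i:{0..n}. ?A i \<times> ?A (n - i)"
  have bij: "bij_betw (\<lambda>(i, s, c). graft s c) ?P (?A n - {Node []})"
    unfolding bij_betw_def
  proof
    show "inj_on (\<lambda>(i, s, c). graft s c) ?P"
      by (auto simp: inj_on_def)
    show "(\<lambda>(i, s, c). graft s c) ` ?P = ?A n - {Node []}"
    proof (intro equalityI subsetI)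
      fix t assume t: "t \<in> ?A n - {Node []}"
      then obtain s c where sc: "t = graft s c"
        by (cases t rule: graft_cases) auto
      then have "(num_nodes s, s, c) \<in> ?P" using t by auto
      then show "t \<in> (\<lambda>(i, s, c). graft s c) ` ?P" using sc by force
    qed auto
  qed
  have "(\<Sum>t | num_nodes t = n. w t) = (if n = 1 then w (Node []) else 0) + sum w (?A n - {Node []})"
    using finite_num_nodes[of n] by (auto simp: sum.remove[of _ "Node []"])
  also have "sum w (?A n - {Node []}) = (\<Sum>(i, s, c)\<in>?P. w (graft s c))"
    using sum.reindex_bij_betw[OF bij, of w] by (simp add: case_prod_unfold)
  also have "\<dots> = (\<Sum>i = 0..n. \<Sum>(s, c)\<in>?A i \<times> ?A (n - i). w (graft s c))"
    by (subst sum.Sigma) (auto simp: finite_num_nodes)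
  also have "\<dots> = (\<Sum>i = 0..n. \<Sum>s\<in>?A i. \<Sum>c\<in>?A (n - i). w (graft s c))"
    by (simp add: sum.cartesian_product)
  finally show ?thesis .
qed

text \<open>Two products are provided for because a weight that contains a node count obeys a
  Leibniz rule under grafting.\<close>

lemma tree_fps_graft2:
  assumes "\<And>s c. w (graft s c) = u s * v c + u' s * v' c"
  shows "tree_fps w = fps_const (w (Node [])) * fps_X
    + tree_fps u * tree_fps v + tree_fps u' * tree_fps v'"
proof (rule fps_ext)
  fix n
  show "fps_nth (tree_fps w) n = fps_nth (fps_const (w (Node [])) * fps_X
      + tree_fps u * tree_fps v + tree_fps u' * tree_fps v') n"
    unfolding tree_fps_nth sum_graft[of w]
    by (simp add: assms fps_mult_nth[of "tree_fps _"] tree_fps_nth sum.distrib sum_product)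
qed

lemma tree_fps_graft:
  assumes "\<And>s c. w (graft s c) = u s * v c"
  shows "tree_fps w = fps_const (w (Node [])) * fps_X + tree_fps u * tree_fps v"
  using tree_fps_graft2[of w u v "\<lambda>_. 0" "\<lambda>_. 0"] assms by (simp add: tree_fps_zero)

section \<open>The series \<open>T\<close> and the coefficients of
  \<open>T ^ p * fps_deriv T\<close>\<close>

abbreviation T :: "real fps" where "T \<equiv> tree_fps (\<lambda>_. 1)"

lemma fps_X_eq: "fps_X = T * (1 - T)"
proof -
  have "T = fps_X + T * T"
    using tree_fps_graft[of "\<lambda>_. 1" "\<lambda>_. 1" "\<lambda>_. 1"] by (simp only: fps_const_1_eq_1 mult_1 mult_1_right)
  then show ?thesis by (rule affine_fixed_point[symmetric])
qed

lemma T_nth_0: "fps_nth T 0 = 0"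
  using num_nodes_pos by (simp add: tree_fps_nth less_imp_neq[symmetric] del: sum_constant)

lemma deriv_T: "fps_deriv T * (1 - 2 * T) = 1"
proof -
  have "fps_deriv (T * (1 - T)) = 1" by (simp flip: fps_X_eq)
  then show ?thesis by (simp add: algebra_simps)
qed

text \<open>The quantity \<open>2 * j - p\<close>, the upper index of the binomial coefficient,
  drops in every recursive use, so it serves as the induction measure.\<close>

lemma T_power_deriv_nth:
  "fps_nth (T ^ p * fps_deriv T) j = (if p \<le> j then real ((2 * j - p) choose j) else 0)"
proof (induction "2 * j - p" arbitrary: j p rule: less_induct)
  case less
  show ?case
  proof (cases "p \<le> j")
    case False
    have "fps_nth (T ^ p) i = 0" if "i < p" for i
      using that T_nth_0 startsby_zero_power_prefix by blast
    then show ?thesis using False by (simp add: fps_mult_nth)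
  next
    case le: True
    show ?thesis
    proof (cases p)
      case 0
      \<comment> \<open>For \<open>p = 0\<close> Pascal's rule would need a negative exponent. The
        identity \<open>T' = 1 + 2 T T'\<close> reduces to \<open>p = 1\<close> instead, matching
        the symmetry of the central binomial coefficient.\<close>
      have eq: "fps_nth (fps_deriv T) j = (if j = 0 then 1 else 0) + 2 * fps_nth (T ^ 1 * fps_deriv T) j"
      proof -
        have "fps_deriv T = fps_deriv T * (1 - 2 * T) + 2 * (T * fps_deriv T)"
          by (simp add: algebra_simps)
        then have "fps_deriv T = 1 + fps_const 2 * (T * fps_deriv T)"
          unfolding deriv_T by (simp only: numeral_fps_const)
        then have "fps_nth (fps_deriv T) j = fps_nth (1 + fps_const 2 * (T * fps_deriv T)) j"
          by (rule arg_cong)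
        then show ?thesis by (simp only: fps_add_nth fps_mult_left_const_nth fps_one_nth power_one_right)
      qed
      show ?thesis
      proof (cases j)
        case j0: 0
        have "fps_nth (T ^ 1 * fps_deriv T) 0 = 0" using T_nth_0 by simp
        then show ?thesis using eq 0 j0 by (simp del: fps_mult_nth_0)
      next
        case (Suc i)
        have "fps_nth (T ^ 1 * fps_deriv T) j = real ((2 * j - 1) choose j)"
          using less[of j 1] Suc 0 by simp
        moreover have "(2 * j) choose j = 2 * ((2 * j - 1) choose j)"
          using Suc binomial_symmetric[of i "2 * i + 1"] by simp
        ultimately show ?thesis using eq 0 Suc by simp
      qed
    next
      case (Suc q)
      then obtain i where i: "j = Suc i" using le by (cases j) auto
      have "T ^ p * fps_deriv T = T * (1 - T) * (T ^ q * fps_deriv T) + T ^ (q + 2) * fps_deriv T"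
        by (simp add: Suc algebra_simps)
      then have "fps_nth (T ^ p * fps_deriv T) j
          = fps_nth (T ^ q * fps_deriv T) i + fps_nth (T ^ (q + 2) * fps_deriv T) j"
        by (simp add: i flip: fps_X_eq)
      also have "fps_nth (T ^ q * fps_deriv T) i = real ((2 * i - q) choose i)"
        using less[of i q] Suc i le by simp
      \<comment> \<open>If \<open>q + 2 > j\<close>, both sides are 0, since then
        \<open>2 * i - q < j\<close>.\<close>
      also have "fps_nth (T ^ (q + 2) * fps_deriv T) j = real ((2 * i - q) choose j)"
        using less[of j "q + 2"] Suc i le by (auto simp: binomial_eq_0)
      finally have "fps_nth (T ^ p * fps_deriv T) j = real (Suc (2 * i - q) choose Suc i)"
        using i by simp
      also have "Suc (2 * i - q) = 2 * j - p" using i Suc le by simp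
      finally show ?thesis using le i by simp
    qed
  qed
qed

section \<open>Rightmost paths and iterated reductions\<close>

declare rightmost_leaf.simps [simp del]

lemma rightmost_leaf_leaf [simp]: "rightmost_leaf (Node []) = []"
  by (simp add: rightmost_leaf.simps)

lemma rightmost_leaf_graft [simp]:
  "rightmost_leaf (graft s c) = length (children s) # rightmost_leaf c"
  by (cases s) (simp add: rightmost_leaf.simps)

text \<open>This depth is measured inside a branch, one less than the distance to the root of the
  whole tree; odd distance therefore becomes even \<open>rlen\<close>.\<close>

definition rlen :: "plane_tree \<Rightarrow> nat" where
  "rlen t = length (rightmost_leaf t)"

lemma rlen_simps [simp]: "rlen (Node []) = 0" "rlen (graft s c) = Suc (rlen c)"
  by (simp_all add: rlen_def)

text \<open>The node \<open>m\<close> levels above the rightmost leaf becomes a leaf, so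
  \<open>trim 2\<close> is the effect of one reduction on a surviving branch. Only
  \<open>m \<le> rlen c\<close> is meaningful.\<close>

definition trim :: "nat \<Rightarrow> plane_tree \<Rightarrow> plane_tree" where
  "trim m c = delete_descendants (take (rlen c - m) (rightmost_leaf c)) c"

lemma trim_self [simp]: "trim (rlen c) c = Node []"
  by (cases c) (simp add: trim_def)

lemma trim_graft [simp]: "m \<le> rlen c \<Longrightarrow> trim m (graft s c) = graft s (trim m c)"
  by (cases s) (simp add: trim_def Suc_diff_le rightmost_leaf_graft[of "Node _", simplified graft_Node]
    rlen_simps(2)[of "Node _", simplified graft_Node])

lemma rlen_trim: "m \<le> rlen c \<Longrightarrow> rlen (trim m c) = rlen c - m"
proof (induction c rule: graft_induct)
  case leaf
  then show ?case using trim_self[of "Node []"] by simp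
next
  case (graft s c)
  show ?case
  proof (cases "m \<le> rlen c")
    case False
    \<comment> \<open>The only remaining case is a cut at the root of the graft, which leaves a
      single node.\<close>
    then have "m = rlen (graft s c)" using graft by simp
    then show ?thesis by (simp only: trim_self) simp
  qed (simp add: graft Suc_diff_le)
qed

lemma trim_trim: "k + m \<le> rlen c \<Longrightarrow> trim k (trim m c) = trim (k + m) c"
proof (induction c rule: graft_induct)
  case leaf
  then show ?case using trim_self[of "Node []"] by simp
next
  case (graft s c)
  show ?case
  proof (cases "k + m \<le> rlen c")
    case True
    then show ?thesis using graft by (simp add: rlen_trim)
  next
    case False
    then have eq: "k + m = rlen (graft s c)" using graft by simp
    then have "k = rlen (trim m (graft s c))" by (subst rlen_trim) auto
    then show ?thesis using eq trim_self by metis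
  qed
qed

lemma reduction_eq: "reduction t = Node (map (trim 2) (filter (\<lambda>c. rlen c \<noteq> 0) (children t)))"
proof -
  have "butlast (butlast xs) = take (length xs - 2) xs" for xs :: "nat list"
    by (simp add: butlast_conv_take numeral_2_eq_2)
  then show ?thesis by (simp add: reduction_def trim_def rlen_def)
qed

lemma catalan_stanley_iff: "catalan_stanley t \<longleftrightarrow> (\<forall>c\<in>set (children t). even (rlen c))"
  by (simp add: catalan_stanley_def rlen_def)

text \<open>Each reduction lowers a positive \<open>rlen\<close> by 2 and removes branches with
  \<open>rlen\<close> 0, so a branch survives \<open>r\<close> steps exactly if its even
  \<open>rlen\<close> is at least \<open>2 * r\<close>.\<close>

lemma reduction_iterate:
  assumes "catalan_stanley t"
  shows "(reduction ^^ r) t = Node (map (trim (2 * r)) (filter (\<lambda>c. 2 * r \<le> rlen c) (children t)))"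
proof (induction r)
  case 0
  have "trim 0 c = c" for c
  proof (induction c rule: graft_induct)
    case leaf
    then show ?case using trim_self[of "Node []"] by simp
  qed simp
  then show ?case by (cases t) simp
next
  case (Suc r)
  have even: "even (rlen c)" if "c \<in> set (children t)" for c
    using that assms by (simp add: catalan_stanley_iff)
  \<comment> \<open>Evenness enters here: an \<open>rlen\<close> above \<open>2 * r\<close> is at
    least \<open>2 * r + 2\<close>.\<close>
  have "filter (\<lambda>c. 2 * r \<le> rlen c \<and> rlen (trim (2 * r) c) \<noteq> 0) (children t)
      = filter (\<lambda>c. 2 * Suc r \<le> rlen c) (children t)"
  proof (rule filter_cong[OF refl])
    fix c assume "c \<in> set (children t)"
    then obtain k where "rlen c = 2 * k" using even by (blast elim: evenE)
    then show "(2 * r \<le> rlen c \<and> rlen (trim (2 * r) c) \<noteq> 0) = (2 * Suc r \<le> rlen c)"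
      by (auto simp: rlen_trim)
  qed
  moreover have "map (trim 2 \<circ> trim (2 * r)) (filter (\<lambda>c. 2 * Suc r \<le> rlen c) (children t))
      = map (trim (2 * Suc r)) (filter (\<lambda>c. 2 * Suc r \<le> rlen c) (children t))"
    by (rule map_cong) (auto simp: trim_trim)
  ultimately show ?case
    by (simp add: Suc reduction_eq[of "Node _"] filter_map comp_def conj_commute)
qed

lemma catalan_stanley_leaf: "catalan_stanley (Node [])"
  by (simp add: catalan_stanley_iff)

lemma catalan_stanley_graft: "catalan_stanley (graft s c) \<longleftrightarrow> catalan_stanley s \<and> even (rlen c)"
  by (auto simp: catalan_stanley_iff graft_def)

lemma num_nodes_reduction_graft:
  assumes "catalan_stanley s" "even (rlen c)"
  shows "num_nodes ((reduction ^^ r) (graft s c)) = num_nodes ((reduction ^^ r) s)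
    + (if 2 * r \<le> rlen c then num_nodes (trim (2 * r) c) else 0)"
  using assms reduction_iterate[of "graft s c" r] reduction_iterate[of s r]
  by (simp add: catalan_stanley_graft) (simp add: graft_def)

lemma num_nodes_reduction_leaf: "num_nodes ((reduction ^^ r) (Node [])) = 1"
  by (simp add: reduction_iterate catalan_stanley_leaf)

section \<open>Branches by the parity and length of the rightmost path\<close>

lemma tree_fps_rlen_eq: "tree_fps (\<lambda>t. of_bool (rlen t = k)) = fps_X * T ^ k"
proof (induction k)
  case 0
  show ?case
    using tree_fps_graft[of "\<lambda>t. of_bool (rlen t = 0)" "\<lambda>_. 0" "\<lambda>_. 0"] by (simp add: tree_fps_zero)
next
  case (Suc k)
  show ?case
    using tree_fps_graft[of "\<lambda>t. of_bool (rlen t = Suc k)" "\<lambda>_. 1" "\<lambda>t. of_bool (rlen t = k)"]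
    by (simp add: Suc mult_ac)
qed

text \<open>With \<open>m = 0\<close> these are the branches allowed in a Catalan--Stanley tree,
  with \<open>m = 2 * r\<close> those that survive \<open>r\<close> reductions.\<close>

definition long_even :: "nat \<Rightarrow> plane_tree \<Rightarrow> real" where
  "long_even m t = of_bool (even (rlen t) \<and> m \<le> rlen t)"

text \<open>Grafting flips the parity of \<open>rlen\<close>, so the even and odd weights together
  form a closed system.\<close>

definition long_odd :: "nat \<Rightarrow> plane_tree \<Rightarrow> real" where
  "long_odd m t = of_bool (odd (rlen t) \<and> m \<le> rlen t)"

lemma long_odd_leaf [simp]: "long_odd m (Node []) = 0"
  by (simp add: long_odd_def)

text \<open>An odd length never equals the even threshold \<open>m\<close>, so no boundary term
  appears; in the even case the length \<open>m\<close> has to be split off first.\<close>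

lemma long_odd_graft [simp]: "even m \<Longrightarrow> long_odd m (graft s c) = long_even m c"
  by (auto simp: long_odd_def long_even_def le_Suc_eq)

lemma long_even_split:
  "even m \<Longrightarrow> long_even m t = of_bool (rlen t = m) + of_bool (rlen t \<noteq> m) * long_even m t"
  by (auto simp: long_even_def)

lemma long_even_graft:
  "of_bool (rlen (graft s c) \<noteq> m) * long_even m (graft s c) = long_odd m c"
  by (auto simp: long_odd_def long_even_def)

lemma tree_fps_long_odd: "even m \<Longrightarrow> tree_fps (long_odd m) = T * tree_fps (long_even m)"
  using tree_fps_graft[of "long_odd m" "\<lambda>_. 1" "long_even m"] by simp

lemma tree_fps_long_even:
  assumes "even m"
  shows "tree_fps (long_even m) * (1 - T\<^sup>2) = fps_X * T ^ m"
proof -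
  let ?w = "\<lambda>t. of_bool (rlen t \<noteq> m) * long_even m t"
  have "tree_fps (long_even m) = tree_fps (\<lambda>t. of_bool (rlen t = m)) + tree_fps ?w"
    unfolding tree_fps_add[symmetric] using long_even_split[OF assms] by (intro arg_cong[of _ _ tree_fps] ext)
  also have "tree_fps ?w = T * tree_fps (long_odd m)"
    using tree_fps_graft[of ?w "\<lambda>_. 1" "long_odd m"] long_even_graft
    by (auto simp: long_even_def)
  finally have "tree_fps (long_even m) = fps_X * T ^ m + T\<^sup>2 * tree_fps (long_even m)"
    unfolding tree_fps_rlen_eq tree_fps_long_odd[OF assms] power2_eq_square mult.assoc .
  then show ?thesis by (rule affine_fixed_point)
qed

text \<open>Trimmed sizes add up along the spine. Passing from even to odd and back adds two spine
  nodes, and the sizes of the trees at each contribute \<open>T * (fps_X * fps_deriv T)\<close>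
  times the branch series, hence the factor 2.\<close>

lemma tree_fps_trim:
  assumes "even m"
  shows "tree_fps (\<lambda>t. long_even m t * num_nodes (trim m t)) * (1 - T\<^sup>2)
    = fps_X * T ^ m + 2 * T * (fps_X * fps_deriv T) * tree_fps (long_even m)"
    (is "tree_fps ?g * _ = _")
proof -
  let ?h = "\<lambda>t. long_odd m t * num_nodes (trim m t)"
  let ?w = "\<lambda>t. of_bool (rlen t \<noteq> m) * ?g t"
  let ?N = "\<lambda>t. real (num_nodes t)"
  have h: "?h (graft s c) = ?N s * long_even m c + 1 * ?g c" for s c
    using assms by (cases "m \<le> rlen c") (simp_all add: long_even_def algebra_simps)
  \<comment> \<open>Excluding \<open>rlen t = m\<close> removes the case in which the whole graft
    collapses to a single node.\<close>
  have w: "?w (graft s c) = ?N s * long_odd m c + 1 * ?h c" for s c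
    using long_even_graft[of s c m]
    by (cases "m \<le> rlen c") (simp_all add: long_odd_def long_even_def algebra_simps)
  have odd: "tree_fps ?h = tree_fps ?N * tree_fps (long_even m) + T * tree_fps ?g"
    by (subst tree_fps_graft2[of ?h ?N "long_even m" "\<lambda>_. 1" ?g, OF h]) simp
  \<comment> \<open>At length exactly \<open>m\<close> the trimmed branch is one node, so its weight
    is 1.\<close>
  have "?g = (\<lambda>t. of_bool (rlen t = m) + ?w t)"
    using assms by (auto simp: long_even_def fun_eq_iff)
  then have "tree_fps ?g = tree_fps (\<lambda>t. of_bool (rlen t = m)) + tree_fps ?w"
    unfolding tree_fps_add[symmetric] by (rule arg_cong)
  also have "tree_fps ?w = tree_fps ?N * tree_fps (long_odd m) + T * tree_fps ?h"
    by (subst tree_fps_graft2[of ?w ?N "long_odd m" "\<lambda>_. 1" ?h, OF w]) (auto simp: long_even_def)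
  finally have "tree_fps ?g = fps_X * T ^ m
      + (fps_X * fps_deriv T * (T * tree_fps (long_even m))
        + T * (fps_X * fps_deriv T * tree_fps (long_even m) + T * tree_fps ?g))"
    unfolding odd tree_fps_rlen_eq tree_fps_long_odd[OF assms] tree_fps_num_nodes .
  also have "\<dots> = fps_X * T ^ m + 2 * T * (fps_X * fps_deriv T) * tree_fps (long_even m)
      + T\<^sup>2 * tree_fps ?g"
    by (simp add: algebra_simps power2_eq_square)
  finally show ?thesis by (rule affine_fixed_point)
qed

lemma one_minus_T_nonzero: "1 - T \<noteq> 0"
proof
  assume "1 - T = 0"
  then have "fps_nth (1 - T) 0 = 0" by simp
  then show False using T_nth_0 by simp
qed

text \<open>Both \<open>1 - T\<^sup>2\<close> and \<open>fps_X = T * (1 - T)\<close> contain the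
  factor \<open>1 - T\<close>, which cancels in the integral domain of power series.\<close>

lemma tree_fps_long_even_one_plus_T:
  assumes "even m"
  shows "tree_fps (long_even m) * (1 + T) = T ^ Suc m"
proof -
  have "(1 - T) * (tree_fps (long_even m) * (1 + T)) = tree_fps (long_even m) * (1 - T\<^sup>2)"
    by (simp add: algebra_simps power2_eq_square)
  also have "\<dots> = (1 - T) * T ^ Suc m"
    by (simp only: tree_fps_long_even[OF assms] fps_X_eq power_Suc mult_ac)
  finally show ?thesis using one_minus_T_nonzero by simp
qed

section \<open>Generating functions of Catalan--Stanley trees and of their reduced sizes\<close>

abbreviation cs :: "plane_tree \<Rightarrow> real" where
  "cs t \<equiv> of_bool (catalan_stanley t)"

text \<open>Thus \<open>1 + T\<close> is the series of all sequences of admissible branches.\<close>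

lemma one_minus_long_even_0: "(1 - tree_fps (long_even 0)) * (1 + T) = 1"
  by (simp add: left_diff_distrib tree_fps_long_even_one_plus_T)

lemma tree_fps_catalan_stanley: "tree_fps cs = fps_X * (1 + T)"
proof -
  let ?E = "tree_fps (long_even 0)"
  have "cs (graft s c) = cs s * long_even 0 c" for s c
    by (simp add: catalan_stanley_graft long_even_def of_bool_conj)
  from tree_fps_graft[of cs cs "long_even 0", OF this] have "tree_fps cs = fps_X + ?E * tree_fps cs"
    by (simp add: catalan_stanley_leaf mult.commute)
  then have "tree_fps cs * (1 - ?E) = fps_X" by (rule affine_fixed_point)
  then have "tree_fps cs * ((1 - ?E) * (1 + T)) = fps_X * (1 + T)" by (simp flip: mult.assoc)
  then show ?thesis by (simp add: one_minus_long_even_0)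
qed

text \<open>The first summand counts the root of each reduced tree. In the second, one surviving
  branch is marked, and the branches before and after it each contribute a factor
  \<open>1 + T\<close>.\<close>

lemma tree_fps_reduction:
  "tree_fps (\<lambda>t. cs t * num_nodes ((reduction ^^ r) t))
    = fps_X * (1 + T) + fps_X\<^sup>2 * (T ^ (2 * r) * fps_deriv T)"
proof -
  let ?W = "\<lambda>t. cs t * num_nodes ((reduction ^^ r) t)"
  let ?g = "\<lambda>t. long_even (2 * r) t * num_nodes (trim (2 * r) t)"
  let ?E = "tree_fps (long_even 0)" and ?S = "tree_fps cs" and ?G = "tree_fps ?g"
  let ?D = "fps_deriv T" and ?P = "T ^ (2 * r)" and ?L = "tree_fps (long_even (2 * r))"
  have "?W (graft s c) = ?W s * long_even 0 c + cs s * ?g c" for s c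
    by (auto simp: catalan_stanley_graft num_nodes_reduction_graft long_even_def)
  from tree_fps_graft2[of ?W ?W "long_even 0" cs ?g, OF this] have "tree_fps ?W = fps_X + ?S * ?G + ?E * tree_fps ?W"
    by (simp add: num_nodes_reduction_leaf catalan_stanley_leaf mult.commute add_ac)
  then have "tree_fps ?W * (1 - ?E) = fps_X + ?S * ?G" by (rule affine_fixed_point)
  then have "tree_fps ?W * ((1 - ?E) * (1 + T)) = (fps_X + ?S * ?G) * (1 + T)"
    by (simp flip: mult.assoc)
  then have W: "tree_fps ?W = fps_X * (1 + T) + fps_X * ((1 + T)\<^sup>2 * ?G)"
    by (simp only: one_minus_long_even_0 tree_fps_catalan_stanley)
      (simp add: algebra_simps power2_eq_square)
  have L: "?L * (1 + T) = T * ?P" by (simp add: tree_fps_long_even_one_plus_T)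
  have G: "?G * (1 - T\<^sup>2) = fps_X * ?P + 2 * T * (fps_X * ?D) * ?L" by (simp add: tree_fps_trim)
  have "(1 - T) * ((1 + T)\<^sup>2 * ?G) = (1 + T) * (?G * (1 - T\<^sup>2))"
    by (simp add: algebra_simps power2_eq_square)
  also have "\<dots> = fps_X * ?P * (1 + T) + 2 * T * (fps_X * ?D) * (?L * (1 + T))"
    by (simp only: G) (simp add: algebra_simps)
  also have "\<dots> = fps_X * ?P * ((1 + T) * 1 + 2 * T\<^sup>2 * ?D)"
    by (simp only: L) (simp add: algebra_simps power2_eq_square)
  \<comment> \<open>Writing 1 as \<open>T' (1 - 2 T)\<close> makes \<open>T'\<close> a common
    factor; the cofactor is \<open>(1 + T) (1 - 2 T) + 2 T\<^sup>2 = 1 - T\<close>.\<close>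
  also have "\<dots> = fps_X * ?P * ((1 + T) * (?D * (1 - 2 * T)) + 2 * T\<^sup>2 * ?D)"
    by (simp only: deriv_T)
  also have "\<dots> = (1 - T) * (fps_X * ?P * ?D)"
    by (simp add: algebra_simps power2_eq_square)
  finally have "(1 + T)\<^sup>2 * ?G = fps_X * ?P * ?D" using one_minus_T_nonzero by simp
  then show ?thesis by (simp add: W power2_eq_square mult.assoc)
qed

section \<open>From coefficients to the expectation\<close>

lemma sum_catalan_stanley:
  "(\<Sum>t\<in>catalan_stanley_trees n. f t) = fps_nth (tree_fps (\<lambda>t. cs t * f t)) n"
proof -
  have "catalan_stanley_trees n = {t. num_nodes t = n} \<inter> Collect catalan_stanley"
    by (auto simp: catalan_stanley_trees_def)
  then show ?thesis
    by (simp add: tree_fps_nth sum.inter_restrict finite_num_nodes of_bool_def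
        if_distrib[of "\<lambda>x. x * _"] cong: if_cong)
qed

lemma catalan_pos: "catalan m > 0"
  by (simp add: catalan_def)

text \<open>The coefficient of \<open>T'\<close> at \<open>m\<close> is both \<open>m + 1\<close>
  times this one and the central binomial coefficient.\<close>

lemma T_nth_Suc: "fps_nth T (Suc m) = catalan m"
  using T_power_deriv_nth[of 0 m] by (simp add: catalan_def field_simps)

lemma card_catalan_stanley_trees: "real (card (catalan_stanley_trees (Suc (Suc m)))) = catalan m"
  using sum_catalan_stanley[of "\<lambda>_. 1" "Suc (Suc m)"]
  by (simp add: tree_fps_catalan_stanley T_nth_Suc)

theorem mainTheorem12:
  fixes n r :: nat
  assumes "n \<ge> 2" and "r \<ge> 1"
  shows "measure_pmf.expectation (pmf_of_set (catalan_stanley_trees n))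
           (\<lambda>\<tau>. real (num_nodes ((reduction ^^ r) \<tau>)))
         = 1 / catalan (n - 2) * real (int_binomial (2 * int n - 2 * int r - 4) (int n - 2)) + 1"
proof -
  obtain m where n: "n = Suc (Suc m)" using assms(1) by (auto simp: numeral_2_eq_2 dest: less_imp_Suc_add Suc_le_D)
  let ?C = "catalan_stanley_trees n"
  have card: "real (card ?C) = catalan m" by (simp add: n card_catalan_stanley_trees)
  then have "card ?C \<noteq> 0" using catalan_pos[of m] by auto
  then have C: "finite ?C" "?C \<noteq> {}" by (auto intro: card_ge_0_finite)
  \<comment> \<open>With \<open>n = m + 2\<close> the upper index is \<open>2 * m - 2 * r\<close>,
    and it is at least \<open>m\<close> exactly if \<open>2 * r \<le> m\<close>; so the zero
    convention agrees with the vanishing coefficients.\<close>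
  have coefficient: "real (int_binomial (2 * int n - 2 * int r - 4) (int n - 2))
      = fps_nth (T ^ (2 * r) * fps_deriv T) m"
  proof (cases "2 * r \<le> m")
    case True
    then have "nat (2 * int n - 2 * int r - 4) = 2 * m - 2 * r" "nat (int n - 2) = m"
      by (auto simp: n)
    with True show ?thesis by (simp add: T_power_deriv_nth int_binomial_def n)
  qed (auto simp: T_power_deriv_nth int_binomial_def n)
  \<comment> \<open>The term \<open>catalan m\<close> comes from the roots and becomes the summand 1
    after division by the number of trees.\<close>
  have "(\<Sum>t\<in>?C. real (num_nodes ((reduction ^^ r) t)))
      = catalan m + fps_nth (T ^ (2 * r) * fps_deriv T) m"
    by (simp add: sum_catalan_stanley tree_fps_reduction n T_nth_Suc fps_X_power_mult_nth)
  then show ?thesis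
    unfolding coefficient using C card catalan_pos[of m]
    by (simp add: integral_pmf_of_set n add_divide_distrib)
qed

end
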